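(* Let $A\in\mathbb{R}^{d\times n}$ and let $\gamma\ge 0$ be a real constant. Then each of the following three statements holds. 1. Exactly one of the following is true: (a) there exists $w\in\mathrm{lin}(A)$ with $\|w\|=1$ and $A^Tw>\mathbf{0}$; (b) there exists $p\in\triangle$ with $Ap=\mathbf{0}$. 2. Exactly one of the following is true: (a) there exists $w\in\mathrm{lin}(A)$ with $\|w\|=1$ and $A^Tw>\gamma\mathbf{1}$; (b) there exists $p\in\triangle$ with $\|Ap\|\le\gamma$. 3. Exactly one of the following is true: (a) there exists $w\in\mathrm{lin}(A)$ with $\|w\|=1$ and $A^Tw>-\gamma\mathbf{1}$; (b) for every $v\in\mathrm{lin}(A)$ with $\|v\|\le\gamma$ there exists $p_v\in\triangle$ with $v=Ap_v$.
   Context: $\mathrm{lin}(A)=\{A\alpha:\alpha\in\mathbb{R}^n\}\subseteq\mathbb{R}^d$ is the linear span of the columns of $A$; $\triangle=\{p\in\mathbb{R}^n: p\ge\mathbf{0},\ \|p\|_1=1\}$ is the probability simplex; $\|\cdot\|$ is the Euclidean norm; $\mathbf{0}$ and $\mathbf{1}$ are the all-zeros and all-ones vectors. Vector inequalities are componentwise, and $u>v$ means $u_i>v_i$ for every $i$. *)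

theory Defs
  imports "HOL-Analysis.Analysis"
begin

definition lin :: "real^'n^'d \<Rightarrow> (real^'d) set" where
  "lin A = {A *v \<alpha> | \<alpha>. True}"

definition norm1 :: "real^'n \<Rightarrow> real" where
  "norm1 p = (\<Sum>i\<in>UNIV. \<bar>p $ i\<bar>)"

definition prob_simplex :: "(real^'n) set" where
  "prob_simplex = {p. (\<forall>i. p $ i \<ge> 0) \<and> norm1 p = 1}"

(* The order relation < of the library on vectors means "\<le> and not \<ge>";
   strictness in every component needs its own relation. *)
definition vec_gt :: "real^'n \<Rightarrow> real^'n \<Rightarrow> bool"  (infix "\<ggreater>" 50) where
  "u \<ggreater> v \<longleftrightarrow> (\<forall>i. u $ i > v $ i)"

definition exactly_one :: "bool \<Rightarrow> bool \<Rightarrow> bool" where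
  "exactly_one P Q \<longleftrightarrow> (P \<or> Q) \<and> \<not> (P \<and> Q)"

end

(* All three alternatives come from projecting a point v of lin A onto the compact convex set
   K of all A p with p in the simplex. If z is the projection, the normalised vector w = z - v
   satisfies w \<bullet> a \<ge> w \<bullet> v + dist z v for every column a of A.
   The choice v = 0 gives the first two statements, a point v outside K gives the third.
   Conversely, w \<bullet> A p is a weighted mean of the entries of transpose A *v w. *)
theory Submission
  imports Defs
begin

text \<open>Nonnegativity removes the absolute values, leaving linear constraints from which
  convexity and closedness can be read off.\<close>

lemma prob_simplex_altdef:
  "prob_simplex = {p :: real^'n. (\<forall>i. 0 \<le> p $ i) \<and> (\<Sum>i\<in>UNIV. p $ i) = 1}"
  by (auto simp: prob_simplex_def norm1_def)

lemma axis_in_prob_simplex: "axis i 1 \<in> prob_simplex"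
  by (simp add: prob_simplex_altdef axis_def)

lemma convex_prob_simplex: "convex (prob_simplex :: (real^'n) set)"
  by (auto simp: convex_def prob_simplex_altdef sum.distrib simp flip: sum_distrib_left)

lemma compact_prob_simplex: "compact (prob_simplex :: (real^'n) set)"
proof -
  have "norm p \<le> 1" if "p \<in> prob_simplex" for p :: "real^'n"
    using that norm_le_l1_cart[of p] by (simp add: prob_simplex_altdef)
  then have "bounded (prob_simplex :: (real^'n) set)"
    by (auto simp: bounded_iff)
  moreover have "closed (prob_simplex :: (real^'n) set)"
    unfolding prob_simplex_altdef
    by (intro closed_Collect_conj closed_Collect_all closed_Collect_le closed_Collect_eq
        continuous_intros)
  ultimately show ?thesis
    by (simp add: compact_eq_bounded_closed)
qed

lemma subspace_lin: "subspace (lin A)"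
proof -
  have "lin A = range ((*v) A)"
    by (auto simp: lin_def)
  then show ?thesis
    by (simp add: linear_subspace_image)
qed

lemma matrix_mult_in_lin: "A *v p \<in> lin A"
  by (auto simp: lin_def)

text \<open>Column i is written as the image of a vertex of the simplex, so that it is visibly a
  point of the convex set projected onto below.\<close>

lemma transpose_mult_nth: "(transpose A *v w) $ i = w \<bullet> (A *v axis i 1)"
  for A :: "real^'n^'d"
  unfolding matrix_vector_mult_basis
  by (simp add: inner_vec_def matrix_vector_mult_def transpose_def column_def mult.commute)

text \<open>Both v and r are kept general so that one projection argument serves twice: v = 0 with r
  = \<gamma> for a margin, and r = 0 for a point v that is not of the form
  \<open>A *v p\<close>.\<close>

lemma exists_separating_unit_vector:
  fixes A :: "real^'n^'d"
  assumes v: "v \<in> lin A" and r: "0 \<le> r"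
    and far: "\<And>p. p \<in> prob_simplex \<Longrightarrow> r < norm (A *v p - v)"
  shows "\<exists>w \<in> lin A. norm w = 1 \<and> (\<forall>i. w \<bullet> v + r < (transpose A *v w) $ i)"
proof -
  define K where "K = (*v) A ` prob_simplex"
  define z where "z = closest_point K v"
  define w where "w = (z - v) /\<^sub>R norm (z - v)"
  have "compact K"
    unfolding K_def
    by (intro compact_continuous_image compact_prob_simplex linear_continuous_on
        linear_linear[THEN iffD2] matrix_vector_mul_linear)
  then have "closed K"
    by (rule compact_imp_closed)
  have "convex K"
    unfolding K_def by (intro convex_linear_image convex_prob_simplex matrix_vector_mul_linear)
  have "K \<noteq> {}"
    using axis_in_prob_simplex by (auto simp: K_def)
  with \<open>closed K\<close> have "z \<in> K"
    unfolding z_def by (rule closest_point_in_set)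
  then obtain p where p: "p \<in> prob_simplex" "z = A *v p"
    by (auto simp: K_def)
  \<comment> \<open>The minimal distance is attained at a point of K, so the strict bound survives
    passing to the minimum. As r \<ge> 0, it also makes z - v nonzero and the normalisation
    legitimate.\<close>
  have dist: "r < norm (z - v)"
    using far p by simp
  have "w \<in> lin A"
    unfolding w_def p(2)
    by (intro subspace_scale subspace_diff subspace_lin matrix_mult_in_lin v)
  moreover have "norm w = 1"
    using dist r by (simp add: w_def del: zero_less_norm_iff norm_eq_zero)
  moreover have "w \<bullet> v + r < (transpose A *v w) $ i" for i
  proof -
    let ?a = "A *v axis i 1"
    have "?a \<in> K"
      using axis_in_prob_simplex by (auto simp: K_def)
    with \<open>convex K\<close> \<open>closed K\<close> have "(v - z) \<bullet> (?a - z) \<le> 0"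
      unfolding z_def by (rule closest_point_dot)
    \<comment> \<open>Flip the sign of the obtuse-angle inequality at the projection and split ?a -
      v as (?a - z) + (z - v).\<close>
    then have "(z - v) \<bullet> (z - v) \<le> (z - v) \<bullet> (?a - v)"
      by (simp add: algebra_simps inner_commute)
    then have "norm (z - v) * norm (z - v) \<le> (z - v) \<bullet> (?a - v)"
      by (simp add: norm_eq_sqrt_inner)
    then have "norm (z - v) \<le> w \<bullet> (?a - v)"
      using dist r by (simp add: w_def pos_le_divide_eq divide_inverse_commute[symmetric] del: zero_less_norm_iff)
    with dist show ?thesis
      unfolding transpose_mult_nth by (simp add: inner_diff_right)
  qed
  ultimately show ?thesis
    by blast
qed

lemma inner_mult_prob_simplex_gt:
  fixes A :: "real^'n^'d"
  assumes "p \<in> prob_simplex" and gt: "\<And>i. c < (transpose A *v w) $ i"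
  shows "c < w \<bullet> (A *v p)"
proof -
  have nonneg: "0 \<le> p $ i" for i
    using assms(1) by (auto simp: prob_simplex_altdef)
  have sum_1: "(\<Sum>i\<in>UNIV. p $ i) = 1"
    using assms(1) by (auto simp: prob_simplex_altdef)
  \<comment> \<open>Weights with sum 1 cannot all vanish; a positive one makes the comparison of the
    weighted sums strict.\<close>
  from sum_1 obtain j where "p $ j \<noteq> 0"
    by (metis sum.neutral zero_neq_one)
  with nonneg[of j] have "0 < p $ j"
    by simp
  have "c = (\<Sum>i\<in>UNIV. c * p $ i)"
    using sum_1 by (simp flip: sum_distrib_left)
  also have "\<dots> < (\<Sum>i\<in>UNIV. (transpose A *v w) $ i * p $ i)"
  proof (rule sum_strict_mono_ex1)
    show "\<forall>i\<in>UNIV. c * p $ i \<le> (transpose A *v w) $ i * p $ i"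
      using gt nonneg by (simp add: less_imp_le mult_right_mono)
    show "\<exists>i\<in>UNIV. c * p $ i < (transpose A *v w) $ i * p $ i"
      using gt[of j] \<open>0 < p $ j\<close> by (blast intro: mult_strict_right_mono)
  qed simp
  also have "\<dots> = w \<bullet> (A *v p)"
    using dot_lmul_matrix[of w A p] by (simp add: inner_vec_def)
  finally show ?thesis .
qed

text \<open>The two sides exclude each other because they would give \<gamma> < w \<bullet> (A *v p)
  \<le> norm w * norm (A *v p) \<le> \<gamma>.\<close>

lemma alternative_margin:
  fixes A :: "real^'n^'d"
  assumes "\<gamma> \<ge> 0"
  shows "exactly_one
     (\<exists>w \<in> lin A. norm w = 1 \<and> transpose A *v w \<ggreater> \<gamma> *\<^sub>R 1)
     (\<exists>p \<in> prob_simplex. norm (A *v p) \<le> \<gamma>)"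
  unfolding exactly_one_def
proof (intro conjI notI)
  show "(\<exists>w \<in> lin A. norm w = 1 \<and> transpose A *v w \<ggreater> \<gamma> *\<^sub>R 1) \<or>
        (\<exists>p \<in> prob_simplex. norm (A *v p) \<le> \<gamma>)"
    using exists_separating_unit_vector[OF subspace_0[OF subspace_lin] assms, of A]
    by (force simp: vec_gt_def not_le)
next
  assume "(\<exists>w \<in> lin A. norm w = 1 \<and> transpose A *v w \<ggreater> \<gamma> *\<^sub>R 1) \<and>
          (\<exists>p \<in> prob_simplex. norm (A *v p) \<le> \<gamma>)"
  then obtain w p where "norm w = 1" "transpose A *v w \<ggreater> \<gamma> *\<^sub>R 1"
      "p \<in> prob_simplex" "norm (A *v p) \<le> \<gamma>"
    by blast
  moreover from this have "\<gamma> < w \<bullet> (A *v p)"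
    by (intro inner_mult_prob_simplex_gt) (auto simp: vec_gt_def)
  ultimately show False
    using norm_cauchy_schwarz[of w "A *v p"] by simp
qed

lemma alternative_ball:
  fixes A :: "real^'n^'d"
  assumes "\<gamma> \<ge> 0"
  shows "exactly_one
     (\<exists>w \<in> lin A. norm w = 1 \<and> transpose A *v w \<ggreater> - \<gamma> *\<^sub>R 1)
     (\<forall>v \<in> lin A. norm v \<le> \<gamma> \<longrightarrow> (\<exists>p \<in> prob_simplex. v = A *v p))"
    (is "exactly_one ?separable ?ball_covered")
  unfolding exactly_one_def
proof (intro conjI notI)
  show "?separable \<or> ?ball_covered"
  proof (rule disjCI)
    assume "\<not> ?ball_covered"
    then obtain v where v: "v \<in> lin A" "norm v \<le> \<gamma>" "\<forall>p \<in> prob_simplex. v \<noteq> A *v p"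
      by blast
    then have "\<exists>w \<in> lin A. norm w = 1 \<and> (\<forall>i. w \<bullet> v + 0 < (transpose A *v w) $ i)"
      by (intro exists_separating_unit_vector) auto
    then obtain w where w: "w \<in> lin A" "norm w = 1" "\<forall>i. w \<bullet> v < (transpose A *v w) $ i"
      by auto
    \<comment> \<open>Cauchy-Schwarz is applied to -v, since a lower bound on the inner product is
      wanted.\<close>
    have "- \<gamma> \<le> w \<bullet> v"
      using norm_cauchy_schwarz[of w "- v"] v(2) w(2) by simp
    with w have "transpose A *v w \<ggreater> - \<gamma> *\<^sub>R 1"
      by (auto simp: vec_gt_def intro: le_less_trans)
    with w show ?separable
      by blast
  qed
next
  assume both: "?separable \<and> ?ball_covered"
  then obtain w where w: "w \<in> lin A" "norm w = 1" "transpose A *v w \<ggreater> - \<gamma> *\<^sub>R 1"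
    by blast
  \<comment> \<open>This point of the ball of radius \<gamma> minimises the inner product with w,
    with value exactly -\<gamma>; a representation by the simplex would force a value strictly above
    that.\<close>
  have "- \<gamma> *\<^sub>R w \<in> lin A" "norm (- \<gamma> *\<^sub>R w) \<le> \<gamma>"
    using w assms by (auto intro: subspace_scale[OF subspace_lin] subspace_neg[OF subspace_lin])
  with both obtain p where p: "p \<in> prob_simplex" "- \<gamma> *\<^sub>R w = A *v p"
    by blast
  have "- \<gamma> < w \<bullet> (A *v p)"
    using p(1) w(3) by (intro inner_mult_prob_simplex_gt) (auto simp: vec_gt_def)
  also have "\<dots> = - \<gamma>"
    using w(2) by (simp flip: p(2) add: dot_square_norm)
  finally show False
    by simp
qed

theorem theorem1:
  fixes A :: "real^'n^'d" and \<gamma> :: real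
  assumes "\<gamma> \<ge> 0"
  shows
    "exactly_one
       (\<exists>w \<in> lin A. norm w = 1 \<and> transpose A *v w \<ggreater> 0)
       (\<exists>p \<in> prob_simplex. A *v p = 0)
   \<and> exactly_one
       (\<exists>w \<in> lin A. norm w = 1 \<and> transpose A *v w \<ggreater> \<gamma> *\<^sub>R 1)
       (\<exists>p \<in> prob_simplex. norm (A *v p) \<le> \<gamma>)
   \<and> exactly_one
       (\<exists>w \<in> lin A. norm w = 1 \<and> transpose A *v w \<ggreater> - \<gamma> *\<^sub>R 1)
       (\<forall>v \<in> lin A. norm v \<le> \<gamma> \<longrightarrow> (\<exists>p \<in> prob_simplex. v = A *v p))"
  \<comment> \<open>The first alternative is the margin version at \<gamma> = 0, where a norm \<le>
    0 means a zero vector.\<close>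
  using alternative_margin[of 0 A] alternative_margin[OF assms, of A]
    alternative_ball[OF assms, of A]
  by simp

end
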